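(* Let $\mathbb K$ be a field with $\operatorname{char}\mathbb K\ne2$, let $D\in\mathcal S_{\mathbb K}$, and let $X,Y\in\mathbb K[T]$ with $Y\neq0$ and $X^2-DY^2=t\in\{1,-1\}$, the sign of $Y$ chosen so that $\operatorname{ord}(X+Y\sqrt D)<0$. Let $Z\in\mathbb K[T]$ be relatively prime to $X$ with $\deg Z<\deg X$, let $Z/X=[0,a_1,\dots,a_n]$ be its regular continued fraction, and let $k\in\mathbb K^*$ be such that $C_{n+1}(0,a_1,\dots,a_n)=kZ$ and $C_n(a_1,\dots,a_n)=kX$. Then $$\frac{X-kZ+Y\sqrt D}{kX}=\big[\,\overline{2/k,\,-a_1,\dots,-a_n,\,(-1)^{n+1}2t/k,\,a_n,\dots,a_1}\,\big],$$ and in particular $K\!\left(\frac{X-kZ+Y\sqrt D}{kX}\right)\le K(Z/X)$.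
   Context: $\mathbb L=\mathbb K((T^{-1}))$ with $\operatorname{ord}(\sum_{i\le N}c_iT^i)=-N$ if $c_N\ne0$. $\mathcal S_{\mathbb K}$ is the set of polynomials of positive even degree in $\mathbb K[T]$, not squares, with leading coefficient a square in $\mathbb K$; $\sqrt D\in\mathbb L$ is a square root of $D$. Continuant polynomials: $C_{-1}()=0$, $C_0()=1$, $C_{m+1}(x_0,\dots,x_m)=x_mC_m(x_0,\dots,x_{m-1})+C_{m-1}(x_0,\dots,x_{m-2})$. For elements $b_0,\dots,b_m\in\mathbb L$, $[b_0,\dots,b_m]=b_0+1/(b_1+1/(\cdots+1/b_m))$ (where defined), and an infinite expression $[b_0,b_1,\dots]$ means $\lim_m[b_0,\dots,b_m]$ in $\mathbb L$ (for the absolute value $|\alpha|=e^{-\operatorname{ord}\alpha}$); the bar denotes that the block is repeated periodically forever; entries may be constants. The regular continued fraction $[a_0,a_1,\dots]$ of $\alpha\in\mathbb L$ is defined by $\alpha_0=\alpha$, $a_j=\lfloor\alpha_j\rfloor$ (polynomial part), $\alpha_{j+1}=1/(\alpha_j-a_j)$; $K(\alpha)=\sup_{j\ge1}\deg a_j$ (of the regular expansion). *)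

theory Defs
  imports
    "HOL-Computational_Algebra.Computational_Algebra"
    "HOL-Library.Extended_Nat"
begin

text \<open>
  The field \<open>K((T\<inverse>))\<close> is the type \<open>'a fls\<close> of formal Laurent series, whose variable
  \<open>fls_X\<close> is read as \<open>T\<inverse>\<close>; so \<open>fls_X_inv\<close> is \<open>T\<close>, and \<open>ord\<close> is \<open>fls_subdegree\<close> on nonzero
  series (the library sets \<open>fls_subdegree 0 = 0\<close>).  The library metric on \<open>'a fls\<close> is
  \<open>dist a b = 2 powi (- fls_subdegree (a - b))\<close> for \<open>a \<noteq> b\<close>; it has the same convergent
  sequences and limits as the one coming from the absolute value \<open>exp (- ord a)\<close>.
\<close>

definition poly_to_fls :: "'a::field poly \<Rightarrow> 'a fls" where
  "poly_to_fls p = poly (map_poly fls_const p) fls_X_inv"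

text \<open>The library's \<open>fls_prpart\<close> omits the constant term.\<close>

definition pol_part :: "'a::field fls \<Rightarrow> 'a poly" where
  "pol_part f = fls_prpart f + [:fls_nth f 0:]"

definition S_set :: "'a::field poly set" where
  "S_set = {D. degree D > 0 \<and> even (degree D) \<and> (\<nexists>Q. D = Q\<^sup>2) \<and> (\<exists>c. lead_coeff D = c\<^sup>2)}"

text \<open>
  The continuant recursion peels off the last variable, so it is run on the reversed list.
  \<open>C\<^sub>1(x) = x\<close> is \<open>x C\<^sub>0() + C\<^sub>-\<^sub>1()\<close> with \<open>C\<^sub>0() = 1\<close> and \<open>C\<^sub>-\<^sub>1() = 0\<close>.
  The index \<open>m\<close> of \<open>C\<^sub>m\<close> is the length of the list.
\<close>

fun continuant_rev :: "'b::comm_semiring_1 list \<Rightarrow> 'b" where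
  "continuant_rev [] = 1"
| "continuant_rev [x] = x"
| "continuant_rev (x # y # zs) = x * continuant_rev (y # zs) + continuant_rev zs"

definition continuant :: "'b::comm_semiring_1 list \<Rightarrow> 'b" where
  "continuant xs = continuant_rev (rev xs)"

text \<open>\<open>None\<close> means that the expression \<open>[b\<^sub>0, \<dots>, b\<^sub>m]\<close> is undefined (a division by zero occurs).\<close>

fun cf_value :: "'b::field list \<Rightarrow> 'b option" where
  "cf_value [] = None"
| "cf_value [b] = Some b"
| "cf_value (b # c # bs) =
    (case cf_value (c # bs) of
       None \<Rightarrow> None
     | Some v \<Rightarrow> if v = 0 then None else Some (b + 1 / v))"

definition has_cf_limit :: "(nat \<Rightarrow> 'a::field fls) \<Rightarrow> 'a fls \<Rightarrow> bool" where
  "has_cf_limit b \<alpha> \<longleftrightarrow>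
    (\<exists>u. (\<forall>m. cf_value (map b [0..<Suc m]) = Some (u m)) \<and> u \<longlonglongrightarrow> \<alpha>)"

definition periodic :: "'b list \<Rightarrow> nat \<Rightarrow> 'b" where
  "periodic bs m = bs ! (m mod length bs)"

text \<open>
  Complete quotients \<open>\<alpha>\<^sub>j\<close> and partial quotients \<open>a\<^sub>j\<close> of the regular continued fraction;
  \<open>None\<close> means that the expansion has stopped before index \<open>j\<close>.
\<close>

primrec complete_quotient :: "'a::field fls \<Rightarrow> nat \<Rightarrow> 'a fls option" where
  "complete_quotient \<alpha> 0 = Some \<alpha>"
| "complete_quotient \<alpha> (Suc j) =
    (case complete_quotient \<alpha> j of
       None \<Rightarrow> None
     | Some \<beta> \<Rightarrow> if \<beta> = poly_to_fls (pol_part \<beta>) then None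
               else Some (1 / (\<beta> - poly_to_fls (pol_part \<beta>))))"

definition partial_quotient :: "'a::field fls \<Rightarrow> nat \<Rightarrow> 'a poly option" where
  "partial_quotient \<alpha> j = map_option pol_part (complete_quotient \<alpha> j)"

definition has_finite_regular_cf :: "'a::field fls \<Rightarrow> 'a poly list \<Rightarrow> bool" where
  "has_finite_regular_cf \<alpha> as \<longleftrightarrow>
    (\<forall>j. partial_quotient \<alpha> j = (if j < length as then Some (as ! j) else None))"

definition K_sup :: "'a::field fls \<Rightarrow> enat" where
  "K_sup \<alpha> = Sup {enat (degree a) | a j. j \<ge> 1 \<and> partial_quotient \<alpha> j = Some a}"

end

theory Submission
  imports Defs
begin

text \<open>
  The block has \<open>\<alpha>\<close> as a fixed point: with \<open>\<epsilon> = X + Y \<surd>D\<close>, so that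
  \<open>X - Y \<surd>D = t / \<epsilon>\<close>, the tails of \<open>[block, \<alpha>]\<close> are computed from the last entry
  backwards by the continuant matrix of \<open>a\<^sub>1, \<dots>, a\<^sub>n\<close> and its transpose.  The nonzero
  constants in the block are isolated between polynomials of positive degree.  Hence
  every tail has the order of its first entry, each entry after the first contributes
  twice its degree to the order of the error, and the periodic expression converges to
  \<open>\<alpha>\<close>.  In passing to the regular expansion, the constants are absorbed by affine changes
  \<open>u x + s\<close> of the complete quotients with \<open>u, s\<close> constant, which preserve the degrees of
  the other entries.
\<close>

section \<open>Polynomials as Laurent series in the inverse variable\<close>

lemma poly_to_fls_0 [simp]: "poly_to_fls 0 = 0"
  by (simp add: poly_to_fls_def)

lemma poly_to_fls_pCons: "poly_to_fls (pCons c p) = fls_const c + fls_X_inv * poly_to_fls p"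
  by (simp add: poly_to_fls_def map_poly_pCons)

lemma poly_to_fls_const [simp]: "poly_to_fls [:c:] = fls_const c"
  by (simp add: poly_to_fls_pCons)

lemma poly_to_fls_1 [simp]: "poly_to_fls 1 = 1"
  using poly_to_fls_const[of 1] by (simp add: one_pCons)

lemma poly_to_fls_nth:
  "fls_nth (poly_to_fls p) i = (if i \<le> 0 then coeff p (nat (- i)) else 0)"
proof (induction p arbitrary: i)
  case (pCons c p)
  have "nat (- i) = Suc (nat (- (i + 1)))" if "i < 0"
    using that by simp
  then show ?case
    by (auto simp: poly_to_fls_pCons fls_X_inv_times_conv_shift pCons.IH coeff_pCons
        split: nat.splits)
qed simp

lemma poly_to_fls_add: "poly_to_fls (p + q) = poly_to_fls p + poly_to_fls q"
  by (rule fls_eqI) (simp add: poly_to_fls_nth)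

lemma poly_to_fls_minus: "poly_to_fls (- p) = - poly_to_fls p"
  by (rule fls_eqI) (simp add: poly_to_fls_nth)

lemma poly_to_fls_diff: "poly_to_fls (p - q) = poly_to_fls p - poly_to_fls q"
  by (rule fls_eqI) (simp add: poly_to_fls_nth)

lemma poly_to_fls_smult: "poly_to_fls (smult c p) = fls_const c * poly_to_fls p"
  by (rule fls_eqI) (simp add: poly_to_fls_nth)

lemma poly_to_fls_mult: "poly_to_fls (p * q) = poly_to_fls p * poly_to_fls q"
  by (induction p)
    (simp_all add: poly_to_fls_pCons poly_to_fls_add poly_to_fls_smult algebra_simps)

lemma poly_to_fls_eq_0_iff [simp]: "poly_to_fls p = 0 \<longleftrightarrow> p = 0"
proof
  assume "poly_to_fls p = 0"
  then have "fls_nth (poly_to_fls p) (- int i) = 0" for i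
    by simp
  then show "p = 0"
    by (intro poly_eqI) (simp add: poly_to_fls_nth)
qed simp

lemma fls_subdegree_poly_to_fls: "fls_subdegree (poly_to_fls p) = - int (degree p)"
proof (cases "p = 0")
  case False
  show ?thesis
  proof (rule antisym)
    show "fls_subdegree (poly_to_fls p) \<le> - int (degree p)"
      using False by (intro fls_subdegree_leI) (simp add: poly_to_fls_nth)
    show "- int (degree p) \<le> fls_subdegree (poly_to_fls p)"
      using False by (intro fls_subdegree_geI) (auto simp: poly_to_fls_nth intro!: coeff_eq_0)
  qed
qed simp

section \<open>Polynomial parts, orders and limits of Laurent series\<close>

lemma coeff_pol_part: "coeff (pol_part f) i = fls_nth f (- int i)"
  by (cases i) (auto simp: pol_part_def)

lemma pol_part_eqI:
  assumes "f = poly_to_fls p + g" and "g = 0 \<or> fls_subdegree g > 0"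
  shows "pol_part f = p"
proof (rule poly_eqI)
  fix i
  have "fls_nth g (- int i) = 0"
    using assms(2) by auto
  then show "coeff (pol_part f) i = coeff p i"
    by (simp add: coeff_pol_part assms(1) poly_to_fls_nth)
qed

lemma degree_pol_part:
  assumes "fls_subdegree f < 0"
  shows "int (degree (pol_part f)) = - fls_subdegree f"
proof -
  have "degree (fls_prpart f + [:fls_nth f 0:]) = degree (fls_prpart f)"
    using assms by (intro degree_add_eq_left) simp
  then show ?thesis
    using assms by (simp add: pol_part_def)
qed

lemma fls_subdegree_sub_pol_part:
  assumes "f \<noteq> poly_to_fls (pol_part f)"
  shows "fls_subdegree (f - poly_to_fls (pol_part f)) > 0"
  using assms by (intro fls_subdegree_greaterI) (auto simp: poly_to_fls_nth coeff_pol_part)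

lemma fls_subdegree_one_divide [simp]:
  fixes f :: "'a::field fls"
  assumes "f \<noteq> 0"
  shows "fls_subdegree (1 / f) = - fls_subdegree f"
  using assms by (simp add: fls_divide_subdegree)

text \<open>A remainder after removing the polynomial part has positive order, so its reciprocal has
  negative order.\<close>

lemma degree_partial_quotient_pos:
  assumes "partial_quotient f (Suc j) = Some a"
  shows "degree a > 0"
proof -
  obtain g where g: "complete_quotient f j = Some g" "g \<noteq> poly_to_fls (pol_part g)"
    and a: "a = pol_part (1 / (g - poly_to_fls (pol_part g)))"
    using assms by (auto simp: partial_quotient_def split: option.splits if_splits)
  have "fls_subdegree (1 / (g - poly_to_fls (pol_part g))) < 0"
    using g(2) fls_subdegree_sub_pol_part[OF g(2)] by simp
  from degree_pol_part[OF this] this show ?thesis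
    unfolding a by linarith
qed

text \<open>The case \<open>u m = f\<close> is separate because \<open>fls_subdegree 0 = 0\<close>
  would violate the bound.\<close>

lemma tendsto_flsI:
  fixes u :: "nat \<Rightarrow> 'a::field fls"
  assumes "\<And>m. u m = f \<or> fls_subdegree (u m - f) \<ge> int m"
  shows "u \<longlonglongrightarrow> f"
proof (rule metric_tendsto_imp_tendsto)
  show "(\<lambda>m. inverse (2 ^ m :: real)) \<longlonglongrightarrow> 0"
    by (rule LIMSEQ_inverse_realpow_zero) simp
  have "dist (u m) f \<le> inverse (2 ^ m)" for m
  proof (cases "u m = f")
    case False
    then have ge: "fls_subdegree (u m - f) \<ge> int m"
      using assms by blast
    then have "(2 :: real) ^ m \<le> 2 ^ nat (fls_subdegree (u m - f))"
      by (intro power_increasing) auto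
    with False ge show ?thesis
      by (simp add: dist_fls_def)
  qed simp
  then show "\<forall>\<^sub>F m in sequentially. dist (u m) f \<le> dist (inverse (2 ^ m :: real)) 0"
    by simp
qed

section \<open>Continued fractions with isolated constant partial quotients\<close>

text \<open>The bound puts the order of \<open>1 / y\<close> strictly above that of
  \<open>p\<close>, so nothing cancels. A constant \<open>p\<close> is covered when \<open>y\<close>
  has negative order.\<close>

lemma poly_add_one_divide:
  assumes "p \<noteq> 0" "y \<noteq> 0" "fls_subdegree y < int (degree p)"
  shows "poly_to_fls p + 1 / y \<noteq> 0"
    and "fls_subdegree (poly_to_fls p + 1 / y) = - int (degree p)"
proof -
  have lt: "fls_subdegree (poly_to_fls p) < fls_subdegree (1 / y)"
    using assms by (simp add: fls_subdegree_poly_to_fls)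
  show "fls_subdegree (poly_to_fls p + 1 / y) = - int (degree p)"
    using fls_subdegree_add_eq1[OF _ lt] assms(1) by (simp add: fls_subdegree_poly_to_fls)
  show "poly_to_fls p + 1 / y \<noteq> 0"
  proof
    assume "poly_to_fls p + 1 / y = 0"
    then have "poly_to_fls p = - (1 / y)"
      by (simp add: eq_neg_iff_add_eq_0)
    then have "fls_subdegree (poly_to_fls p) = fls_subdegree (1 / y)"
      by simp
    with lt show False
      by simp
  qed
qed

text \<open>Regularity is relaxed to allow isolated constants. \<open>A i\<close> plays the role of
  the infinite tail starting at \<open>q i\<close>; no limit is presupposed.\<close>

locale cf_expansion =
  fixes q :: "nat \<Rightarrow> 'a::field poly" and A :: "nat \<Rightarrow> 'a fls"
  assumes q_nz: "q i \<noteq> 0"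
    and degree_adjacent: "degree (q i) + degree (q (Suc i)) > 0"
    and A_nz: "A i \<noteq> 0"
    and subdegree_A: "fls_subdegree (A i) = - int (degree (q i))"
    and A_rec: "A i = poly_to_fls (q i) + 1 / A (Suc i)"
begin

text \<open>Inverting gains twice \<open>degree (q (Suc i))\<close> in the order of the error. One
  copy stays in the bound; the other, or else \<open>degree (q (Suc (Suc i)))\<close> from the
  induction hypothesis, pays for the increment of \<open>l\<close>.\<close>

lemma cf_value_approx:
  "\<exists>v. cf_value (map (\<lambda>j. poly_to_fls (q j)) [i..<i + Suc l]) = Some v \<and> v \<noteq> 0
     \<and> fls_subdegree v = - int (degree (q i))
     \<and> (v = A i \<or> fls_subdegree (v - A i) \<ge> int l + int (degree (q (Suc i))))"
proof (induction l arbitrary: i)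
  case 0
  have "poly_to_fls (q i) - A i = - (1 / A (Suc i))"
    using A_rec[of i] by (simp add: algebra_simps)
  then have "fls_subdegree (poly_to_fls (q i) - A i) = int (degree (q (Suc i)))"
    by (simp add: A_nz subdegree_A)
  then show ?case
    by (simp add: q_nz fls_subdegree_poly_to_fls)
next
  case (Suc l)
  let ?b = "\<lambda>j. poly_to_fls (q j)"
  obtain v where v: "cf_value (map ?b [Suc i..<Suc i + Suc l]) = Some v" "v \<noteq> 0"
    "fls_subdegree v = - int (degree (q (Suc i)))"
    "v = A (Suc i) \<or>
     fls_subdegree (v - A (Suc i)) \<ge> int l + int (degree (q (Suc (Suc i))))"
    using Suc.IH by blast
  let ?v = "?b i + 1 / v"
  have "[i..<i + Suc (Suc l)] = i # Suc i # [Suc (Suc i)..<Suc i + Suc l]"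
    "[Suc i..<Suc i + Suc l] = Suc i # [Suc (Suc i)..<Suc i + Suc l]"
    by (simp_all add: upt_conv_Cons del: upt_Suc)
  with v(1,2) have val: "cf_value (map ?b [i..<i + Suc (Suc l)]) = Some ?v"
    by (simp del: upt_Suc)
  have "fls_subdegree v < int (degree (q i))"
    using v(3) degree_adjacent[of i] by linarith
  note nz = poly_add_one_divide[OF q_nz v(2) this]
  have "?v = A i \<or> fls_subdegree (?v - A i) \<ge> int (Suc l) + int (degree (q (Suc i)))"
  proof (cases "v = A (Suc i)")
    case True
    then show ?thesis
      using A_rec[of i] by simp
  next
    case False
    have "?v - A i = 1 / v - 1 / A (Suc i)"
      by (subst A_rec) simp
    also have "\<dots> = (A (Suc i) - v) / (v * A (Suc i))"
      using v(2) A_nz by (simp add: field_simps)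
    finally have "fls_subdegree (?v - A i) =
        fls_subdegree (v - A (Suc i)) + 2 * int (degree (q (Suc i)))"
      using False v(2,3) A_nz[of "Suc i"] subdegree_A[of "Suc i"]
      by (simp add: fls_divide_subdegree fls_subdegree_minus_sym[of v])
    then show ?thesis
      using False v(4) degree_adjacent[of "Suc i"] by linarith
  qed
  with val nz show ?case
    by blast
qed

lemma has_cf_limit: "has_cf_limit (\<lambda>i. poly_to_fls (q i)) (A 0)"
proof -
  have "\<forall>m. \<exists>v. cf_value (map (\<lambda>i. poly_to_fls (q i)) [0..<Suc m]) = Some v \<and>
      (v = A 0 \<or> fls_subdegree (v - A 0) \<ge> int m)"
  proof
    fix m
    from cf_value_approx[of 0 m] obtain v where
      "cf_value (map (\<lambda>i. poly_to_fls (q i)) [0..<0 + Suc m]) = Some v"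
      "v = A 0 \<or> fls_subdegree (v - A 0) \<ge> int m + int (degree (q (Suc 0)))"
      by blast
    then show "\<exists>v. cf_value (map (\<lambda>i. poly_to_fls (q i)) [0..<Suc m]) = Some v \<and>
        (v = A 0 \<or> fls_subdegree (v - A 0) \<ge> int m)"
      by (intro exI[of _ v]) (auto simp del: upt_Suc)
  qed
  then obtain u where "\<forall>m. cf_value (map (\<lambda>i. poly_to_fls (q i)) [0..<Suc m]) = Some (u m) \<and>
      (u m = A 0 \<or> fls_subdegree (u m - A 0) \<ge> int m)"
    by metis
  then show ?thesis
    unfolding has_cf_limit_def by (intro exI[of _ u]) (auto intro!: tendsto_flsI)
qed

text \<open>
  A constant entry \<open>c\<close> is absorbed by the identity
  \<open>1 / (c + 1 / x) = 1 / c - 1 / (c\<^sup>2 x + c)\<close>, which replaces \<open>x\<close> by a complete quotient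
  of the form \<open>u x + s\<close> with constants \<open>u \<noteq> 0\<close> and \<open>s\<close>.
\<close>
lemma next_complete_quotient:
  assumes u: "u \<noteq> 0" and \<beta>: "\<beta> = fls_const u * A i + fls_const s"
  shows "\<exists>i' u' s'. u' \<noteq> 0 \<and> degree (q i') > 0 \<and>
    1 / (\<beta> - poly_to_fls (pol_part \<beta>)) = fls_const u' * A i' + fls_const s'"
proof (cases "degree (q (Suc i)) > 0")
  case True
  \<comment> \<open>The shift \<open>s\<close> joins the polynomial part, and inverting the
    remainder turns the factor \<open>u\<close> into \<open>1 / u\<close> without a shift.\<close>
  let ?g = "fls_const u * (1 / A (Suc i))"
  have "\<beta> = poly_to_fls (smult u (q i) + [:s:]) + ?g"
    unfolding \<beta> by (subst A_rec) (simp add: poly_to_fls_add poly_to_fls_smult algebra_simps)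
  moreover have "fls_subdegree ?g > 0"
    using u True A_nz[of "Suc i"] subdegree_A[of "Suc i"]
    by (subst fls_subdegree_mult) auto
  ultimately have "\<beta> - poly_to_fls (pol_part \<beta>) = ?g"
    using pol_part_eqI by (metis add_diff_cancel_left')
  then have "1 / (\<beta> - poly_to_fls (pol_part \<beta>)) = (1 / fls_const u) * A (Suc i)"
    by simp
  also have "1 / fls_const u = fls_const (1 / u)"
    using fls_const_divide_const[of 1 u] by simp
  finally show ?thesis
    using u True by (intro exI[of _ "Suc i"] exI[of _ "1 / u"] exI[of _ 0]) simp
next
  case False
  then obtain c where c: "q (Suc i) = [:c:]"
    by (metis degree_eq_zeroE neq0_conv)
  have c0: "c \<noteq> 0"
    using q_nz[of "Suc i"] c by auto
  \<comment> \<open>The constant entry is jumped over: the next quotient is affine in the tail two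
    places on, whose entry is nonconstant by \<open>degree_adjacent\<close>.\<close>
  let ?A = "A (Suc (Suc i))"
  let ?d = "fls_const (c\<^sup>2) * ?A + fls_const c"
  have deg: "degree (q (Suc (Suc i))) > 0"
    using degree_adjacent[of "Suc i"] False by simp
  have "fls_subdegree (fls_const (c\<^sup>2) * ?A) < fls_subdegree (fls_const c)"
    using c0 deg A_nz subdegree_A by simp
  from fls_subdegree_add_eq1[OF _ this]
  have sub: "fls_subdegree ?d < 0"
    using c0 deg A_nz subdegree_A by simp
  then have d0: "?d \<noteq> 0"
    by auto
  have d: "?d = fls_const c * (fls_const c * ?A + 1)"
    by (simp add: power2_eq_square algebra_simps flip: fls_const_mult_const)
  have AS: "A (Suc i) = fls_const c + 1 / ?A"
    using A_rec[of "Suc i"] c by simp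
  have "1 / A (Suc i) = 1 / fls_const c - 1 / ?d"
    unfolding AS d using d0[unfolded d] c0 A_nz[of "Suc (Suc i)"] A_nz[of "Suc i", unfolded AS]
    by (simp add: divide_simps)
  also have "1 / fls_const c = fls_const (1 / c)"
    using fls_const_divide_const[of 1 c] by simp
  finally have inv: "1 / A (Suc i) = fls_const (1 / c) - 1 / ?d" .
  let ?g = "- (fls_const u * (1 / ?d))"
  have "fls_const u * (1 / A (Suc i)) = fls_const (u / c) + ?g"
    unfolding inv by (simp add: algebra_simps)
  then have "\<beta> = poly_to_fls (smult u (q i) + [:s + u / c:]) + ?g"
    unfolding \<beta> by (subst A_rec)
      (simp add: poly_to_fls_add poly_to_fls_smult distrib_left flip: fls_plus_const)
  moreover have "fls_subdegree ?g > 0"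
    using u d0 sub by (simp add: fls_divide_subdegree)
  ultimately have "\<beta> - poly_to_fls (pol_part \<beta>) = ?g"
    using pol_part_eqI by (metis add_diff_cancel_left')
  then have "1 / (\<beta> - poly_to_fls (pol_part \<beta>)) = - (1 / fls_const u) * ?d"
    by simp
  also have "- (1 / fls_const u) = fls_const (- 1 / u)"
    using fls_const_divide_const[of "- 1" u] by simp
  also have "fls_const (- 1 / u) * ?d = fls_const (- c\<^sup>2 / u) * ?A + fls_const (- c / u)"
    by (simp add: distrib_left mult.assoc[symmetric])
  finally show ?thesis
    using u c0 deg
    by (intro exI[of _ "Suc (Suc i)"] exI[of _ "- c\<^sup>2 / u"] exI[of _ "- c / u"]) simp
qed

text \<open>Invariant of the regular algorithm, propagated by \<open>next_complete_quotient\<close>.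
  The start \<open>j = 0\<close> is exempt from the degree claim since \<open>q 0\<close> may be
  constant.\<close>

lemma complete_quotient_affine:
  assumes "complete_quotient (A 0) j = Some \<beta>"
  shows "\<exists>i u s. u \<noteq> 0 \<and> (j > 0 \<longrightarrow> degree (q i) > 0) \<and>
    \<beta> = fls_const u * A i + fls_const s"
  using assms
proof (induction j arbitrary: \<beta>)
  case 0
  then show ?case
    by (intro exI[of _ 0] exI[of _ 1] exI[of _ 0]) simp
next
  case (Suc j)
  then obtain \<gamma> where \<gamma>: "complete_quotient (A 0) j = Some \<gamma>"
    and \<beta>: "\<beta> = 1 / (\<gamma> - poly_to_fls (pol_part \<gamma>))"
    by (auto split: option.splits if_splits)
  from Suc.IH[OF \<gamma>] next_complete_quotient show ?case
    unfolding \<beta> by blast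
qed

text \<open>An affine change by constants with nonzero factor preserves a negative order, so the
  polynomial part keeps the degree of an entry.\<close>

lemma degree_partial_quotient:
  assumes "partial_quotient (A 0) j = Some a" "j > 0"
  obtains i where "degree (q i) > 0" "degree a = degree (q i)"
proof -
  obtain \<beta> where \<beta>: "complete_quotient (A 0) j = Some \<beta>" and a: "a = pol_part \<beta>"
    using assms(1) by (auto simp: partial_quotient_def)
  obtain i u s where i: "u \<noteq> 0" "degree (q i) > 0"
    and \<beta>_eq: "\<beta> = fls_const u * A i + fls_const s"
    using complete_quotient_affine[OF \<beta>] assms(2) by blast
  have "fls_subdegree (fls_const u * A i) < fls_subdegree (fls_const s)"
    using i A_nz subdegree_A by simp
  from fls_subdegree_add_eq1[OF _ this] have "fls_subdegree \<beta> = - int (degree (q i))"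
    unfolding \<beta>_eq using i A_nz subdegree_A by simp
  then have "degree a = degree (q i)"
    using degree_pol_part[of \<beta>] i(2) a by simp
  with i(2) show thesis
    by (rule that)
qed

end

section \<open>Finite continued fractions with a prescribed tail\<close>

text \<open>Total, unlike \<open>cf_value\<close>: a zero tail would be inverted to 0, so
  nonvanishing is established separately.\<close>

definition cf_tail :: "'a::field poly list \<Rightarrow> 'a fls \<Rightarrow> 'a fls" where
  "cf_tail qs x = foldr (\<lambda>p y. poly_to_fls p + 1 / y) qs x"

lemma cf_tail_simps [simp]:
  "cf_tail [] x = x"
  "cf_tail (p # qs) x = poly_to_fls p + 1 / cf_tail qs x"
  by (simp_all add: cf_tail_def)

lemma cf_tail_append: "cf_tail (ps @ qs) x = cf_tail ps (cf_tail qs x)"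
  by (simp add: cf_tail_def)

text \<open>No zero entry and no two consecutive constants; the tail counts as a constant.\<close>
primrec isolated_consts :: "'a::field poly list \<Rightarrow> bool" where
  "isolated_consts [] = True"
| "isolated_consts (p # qs) =
    (p \<noteq> 0 \<and> degree p + degree (hd (qs @ [1])) > 0 \<and> isolated_consts qs)"

lemma isolated_consts_append:
  "\<forall>p\<in>set ps. degree p > 0 \<Longrightarrow> isolated_consts (ps @ qs) \<longleftrightarrow> isolated_consts qs"
  by (induction ps) auto

lemma isolated_consts_drop: "isolated_consts qs \<Longrightarrow> isolated_consts (drop i qs)"
  by (induction qs arbitrary: i) (auto simp: drop_Cons split: nat.splits)

text \<open>Induction from the back: isolation yields the inequality required by
  \<open>poly_add_one_divide\<close>. The appended \<open>1\<close> stands in for \<open>x\<close>,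
  which has order 0 like a constant.\<close>

lemma cf_tail_isolated_consts:
  assumes "isolated_consts qs" "x \<noteq> 0" "fls_subdegree x = 0"
  shows "cf_tail qs x \<noteq> 0"
    and "fls_subdegree (cf_tail qs x) = - int (degree (hd (qs @ [1])))"
proof -
  have "cf_tail qs x \<noteq> 0 \<and> fls_subdegree (cf_tail qs x) = - int (degree (hd (qs @ [1])))"
    using assms(1)
  proof (induction qs)
    case (Cons p qs)
    then have "fls_subdegree (cf_tail qs x) < int (degree p)"
      by auto
    then show ?case
      using Cons poly_add_one_divide[of p "cf_tail qs x"] by simp
  qed (use assms in simp)
  then show "cf_tail qs x \<noteq> 0"
    and "fls_subdegree (cf_tail qs x) = - int (degree (hd (qs @ [1])))"
    by auto
qed

text \<open>At the end of the block, the fixed-point equation lets \<open>x\<close> be read as the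
  tail of the whole block. The constant head matches the order 0 of \<open>x\<close>.\<close>

lemma cf_expansion_periodic:
  assumes iso: "isolated_consts qs" and qs: "qs \<noteq> []" and hd: "degree (hd qs) = 0"
    and x: "x \<noteq> 0" "fls_subdegree x = 0" "cf_tail qs x = x"
  shows "cf_expansion (\<lambda>i. qs ! (i mod length qs)) (\<lambda>i. cf_tail (drop (i mod length qs) qs) x)"
proof
  fix i
  let ?N = "length qs"
  let ?r = "i mod ?N"
  let ?rest = "drop (Suc ?r) qs"
  have r: "?r < ?N"
    using qs by simp
  have drop: "drop ?r qs = qs ! ?r # ?rest"
    using r by (simp add: Cons_nth_drop_Suc)
  have iso_r: "isolated_consts (qs ! ?r # ?rest)"
    using isolated_consts_drop[OF iso, of ?r] unfolding drop .
  have next_index: "degree (qs ! (Suc i mod ?N)) = degree (hd (?rest @ [1])) \<and>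
      cf_tail (drop (Suc i mod ?N) qs) x = cf_tail ?rest x"
  proof (cases "Suc ?r < ?N")
    case True
    then have "Suc i mod ?N = Suc ?r"
      by (simp add: mod_Suc)
    then show ?thesis
      using True by (simp add: hd_append hd_drop_conv_nth)
  next
    case False
    then have "Suc ?r = ?N"
      using r by simp
    then have "Suc i mod ?N = 0" "?rest = []"
      by (auto simp: mod_Suc)
    then show ?thesis
      using qs hd x by (simp add: hd_conv_nth)
  qed
  show "qs ! ?r \<noteq> 0" "degree (qs ! ?r) + degree (qs ! (Suc i mod ?N)) > 0"
    using iso_r next_index by auto
  show "cf_tail (drop ?r qs) x \<noteq> 0"
    "fls_subdegree (cf_tail (drop ?r qs) x) = - int (degree (qs ! ?r))"
    using cf_tail_isolated_consts[OF iso_r x(1,2)] unfolding drop by auto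
  show "cf_tail (drop ?r qs) x =
      poly_to_fls (qs ! ?r) + 1 / cf_tail (drop (Suc i mod ?N) qs) x"
    using next_index unfolding drop by simp
qed

section \<open>Continuant matrices\<close>

text \<open>
  The entries \<open>(P, Q, R, S)\<close>, read by rows, of the product of the matrices with
  rows \<open>(a, 1)\<close> and \<open>(1, 0)\<close>.
\<close>
primrec cf_mat :: "'b::comm_ring_1 list \<Rightarrow> 'b \<times> 'b \<times> 'b \<times> 'b" where
  "cf_mat [] = (1, 0, 0, 1)"
| "cf_mat (a # as) = (case cf_mat as of (P, Q, R, S) \<Rightarrow> (a * P + R, a * Q + S, P, Q))"

lemma cf_mat_snoc:
  "cf_mat (as @ [a]) = (case cf_mat as of (P, Q, R, S) \<Rightarrow> (P * a + Q, P, R * a + S, R))"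
  by (induction as) (auto split: prod.splits simp: algebra_simps)

text \<open>Every factor is symmetric, so reversing the product transposes it.\<close>

lemma cf_mat_rev: "cf_mat (rev as) = (case cf_mat as of (P, Q, R, S) \<Rightarrow> (P, R, Q, S))"
  by (induction as) (auto split: prod.splits simp: cf_mat_snoc algebra_simps)

text \<open>Negating \<open>a\<close> in a factor amounts to conjugation by the diagonal matrix with
  entries 1, -1, followed by a change of sign; the conjugations telescope.\<close>

lemma cf_mat_map_uminus:
  "cf_mat (map uminus as) = (case cf_mat as of (P, Q, R, S) \<Rightarrow>
    ((-1) ^ length as * P, - ((-1) ^ length as * Q), - ((-1) ^ length as * R), (-1) ^ length as * S))"
  by (induction as) (auto split: prod.splits simp: algebra_simps)

lemma cf_mat_det: "cf_mat as = (P, Q, R, S) \<Longrightarrow> P * S - Q * R = (-1) ^ length as"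
proof (induction as arbitrary: P Q R S)
  case (Cons a as)
  obtain P' Q' R' S' where m: "cf_mat as = (P', Q', R', S')"
    by (metis prod_cases4)
  from Cons.IH[OF this] show ?case
    using Cons.prems m by (auto simp: algebra_simps)
qed simp

lemma continuant_rev_cf_mat: "fst (cf_mat xs) = continuant_rev xs"
  by (induction xs rule: continuant_rev.induct) (auto split: prod.splits)

text \<open>Transposition fixes the first entry, so continuants are invariant under reversal; a
  leading 0 moves \<open>R\<close> to the first entry.\<close>

lemma continuant_cf_mat:
  assumes "cf_mat as = (P, Q, R, S)"
  shows "continuant as = P" and "continuant (0 # as) = R"
proof -
  have fst_rev: "fst (cf_mat (rev xs)) = fst (cf_mat xs)" for xs :: "'a list"
    by (simp add: cf_mat_rev split: prod.splits)
  show "continuant as = P"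
    using fst_rev[of as] assms by (simp add: continuant_def flip: continuant_rev_cf_mat)
  show "continuant (0 # as) = R"
    using fst_rev[of "0 # as"] assms
    by (simp add: continuant_def del: rev.simps flip: continuant_rev_cf_mat)
qed

text \<open>The matrix acts on \<open>x\<close> as a Moebius map, written without a quotient so that
  its denominator need not be shown nonzero. Order at most 0 is the invariant that keeps the tails
  nonzero.\<close>

lemma cf_tail_mobius:
  assumes "\<And>p. p \<in> set ps \<Longrightarrow> degree p > 0" "x \<noteq> 0" "fls_subdegree x \<le> 0"
    and "cf_mat ps = (P, Q, R, S)"
  shows "cf_tail ps x \<noteq> 0 \<and> fls_subdegree (cf_tail ps x) \<le> 0 \<and>
    cf_tail ps x * (poly_to_fls R * x + poly_to_fls S) = poly_to_fls P * x + poly_to_fls Q"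
  using assms
proof (induction ps arbitrary: P Q R S)
  case (Cons p ps)
  obtain P' Q' R' S' where m: "cf_mat ps = (P', Q', R', S')"
    by (metis prod_cases4)
  have PQRS: "P = p * P' + R'" "Q = p * Q' + S'" "R = P'" "S = Q'"
    using Cons.prems(4) m by auto
  let ?y = "cf_tail ps x"
  have IH: "?y \<noteq> 0" "fls_subdegree ?y \<le> 0"
    "?y * (poly_to_fls R' * x + poly_to_fls S') = poly_to_fls P' * x + poly_to_fls Q'"
    using Cons.IH[OF _ Cons.prems(2,3) m] Cons.prems(1) by auto
  have "degree p > 0"
    using Cons.prems(1) by simp
  then have lt: "fls_subdegree ?y < int (degree p)" and "p \<noteq> 0"
    using IH(2) by auto
  note nz = poly_add_one_divide[OF this(2) IH(1) lt]
  have "1 / ?y * (poly_to_fls P' * x + poly_to_fls Q') = poly_to_fls R' * x + poly_to_fls S'"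
    using IH(1) by (simp flip: IH(3))
  then have "cf_tail (p # ps) x * (poly_to_fls R * x + poly_to_fls S) =
      poly_to_fls P * x + poly_to_fls Q"
    by (simp add: PQRS poly_to_fls_add poly_to_fls_mult algebra_simps)
  with nz show ?case
    by simp
qed simp

text \<open>
  Here \<open>y\<close>, \<open>w\<close> and \<open>x\<close> are the values of the tails of the block that start with \<open>a\<^sub>n\<close>,
  with the constant \<open>- 2 s t / k\<close> and with \<open>- a\<^sub>1\<close>; the proof shows
  \<open>w = (Q - s t \<epsilon>) / P\<close>.
\<close>
lemma block_fixed_point:
  fixes P Q R S \<alpha> \<epsilon> \<epsilon>' s t k X y w x :: "'b::field"
  assumes nz: "P \<noteq> 0" "k \<noteq> 0" "y \<noteq> 0" "x \<noteq> 0"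
    and sq: "s * s = 1" "t * t = 1"
    and det: "P * S - Q * R = s"
    and P: "P = k * X"
    and \<alpha>: "P * \<alpha> = \<epsilon> - R"
    and \<epsilon>: "\<epsilon> * \<epsilon>' = t" "\<epsilon> + \<epsilon>' = 2 * X"
    and y: "y * (Q * \<alpha> + S) = P * \<alpha> + R"
    and w: "w = - s * 2 * t / k + 1 / y"
    and x: "x * (- R * w + S) = P * w - Q"
  shows "2 / k + 1 / x = \<alpha>"
proof -
  have nz': "\<epsilon> \<noteq> 0" "t \<noteq> 0" "s \<noteq> 0"
    using sq \<epsilon> by auto
  \<comment> \<open>The assumption on \<open>P * \<alpha>\<close> makes
    \<open>P * \<alpha> + R\<close> equal to \<open>\<epsilon>\<close>.\<close>
  have "1 / y = (Q * \<alpha> + S) / \<epsilon>"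
    using y \<alpha> nz nz' by (simp add: field_simps)
  then have "P * (1 / y) * \<epsilon> = Q * (P * \<alpha>) + P * S"
    using nz' by (simp add: algebra_simps add_divide_distrib)
  also have "\<dots> = Q * \<epsilon> + s"
    unfolding \<alpha> using det by (simp add: algebra_simps)
  finally have Py: "P * (1 / y) * \<epsilon> = Q * \<epsilon> + s" .
  have "P * w * \<epsilon> = - s * t * (2 * X) * \<epsilon> + P * (1 / y) * \<epsilon>"
    unfolding w using nz P by (simp add: field_simps)
  also have "\<dots> = - s * t * (\<epsilon> * \<epsilon> + \<epsilon> * \<epsilon>') + Q * \<epsilon> + s"
    unfolding Py \<epsilon>(2)[symmetric] by (simp add: algebra_simps)
  \<comment> \<open>Since \<open>t * t = 1\<close>, the term \<open>- s * t * t\<close> cancels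
    \<open>s\<close>.\<close>
  also have "\<dots> = (Q - s * t * \<epsilon>) * \<epsilon>"
    unfolding \<epsilon>(1) using sq by (simp add: algebra_simps)
  finally have Pw: "P * w = Q - s * t * \<epsilon>"
    using nz' by simp
  have "P * (- R * w + S) = - R * (P * w) + P * S"
    by (simp add: algebra_simps)
  also have "\<dots> = s + s * t * \<epsilon> * R"
    unfolding Pw using det by (simp add: algebra_simps)
  finally have "x * (s + s * t * \<epsilon> * R) = P * (P * w - Q)"
    using x by (metis mult.left_commute)
  then have "s * (x * (1 + t * \<epsilon> * R)) = s * (- (t * \<epsilon> * P))"
    unfolding Pw by (simp add: algebra_simps)
  then have x': "x * (1 + t * \<epsilon> * R) = - (t * \<epsilon> * P)"
    using nz'(3) mult_left_cancel by blast
  have "P * (1 / x) * (t * \<epsilon>) = - (- (t * \<epsilon> * P)) / x"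
    by simp
  also have "\<dots> = - (1 + t * \<epsilon> * R)"
    unfolding x'[symmetric] using nz by simp
  \<comment> \<open>The summand 1 is rewritten as
    \<open>t * \<epsilon> * \<epsilon>'\<close>.\<close>
  also have "\<dots> = (- \<epsilon>' - R) * (t * \<epsilon>)"
    using sq(2) \<epsilon>(1) by (simp add: algebra_simps) (metis mult.left_commute mult.commute)
  finally have "P * (1 / x) * (t * \<epsilon>) = (- \<epsilon>' - R) * (t * \<epsilon>)" .
  then have "P * (1 / x) = - \<epsilon>' - R"
    using nz' by (metis mult_right_cancel no_zero_divisors)
  then have "P * (2 / k + 1 / x) = 2 * X - \<epsilon>' - R"
    using P nz by (simp add: distrib_left)
  also have "\<dots> = P * \<alpha>"
    unfolding \<alpha> \<epsilon>(2)[symmetric] by simp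
  finally show ?thesis
    using nz by simp
qed

theorem mainTheorem5:
  fixes D X Y Z :: "'a::field poly"
    and sqrtD \<alpha> :: "'a fls"
    and t k :: 'a
    and as :: "'a poly list"
    and n :: nat
  assumes "CHAR('a) \<noteq> 2"
    and "D \<in> S_set"
    and "sqrtD\<^sup>2 = poly_to_fls D"
    and "Y \<noteq> 0"
    and "t \<in> {1, -1}"
    and "X\<^sup>2 - D * Y\<^sup>2 = [:t:]"
    and "fls_subdegree (poly_to_fls X + poly_to_fls Y * sqrtD) < 0"
    and "coprime Z X"
    and "degree Z < degree X"
    and "length as = n"
    and "has_finite_regular_cf (poly_to_fls Z / poly_to_fls X) (0 # as)"
    and "k \<noteq> 0"
    and "continuant (0 # as) = smult k Z"
    and "continuant as = smult k X"
    and "\<alpha> = (poly_to_fls X - fls_const k * poly_to_fls Z + poly_to_fls Y * sqrtD)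
              / (fls_const k * poly_to_fls X)"
  shows "has_cf_limit
          (periodic
            ([fls_const (2 / k)]
             @ map (\<lambda>a. - poly_to_fls a) as
             @ [fls_const ((-1) ^ (n + 1) * 2 * t / k)]
             @ map poly_to_fls (rev as))) \<alpha>
       \<and> K_sup \<alpha> \<le> K_sup (poly_to_fls Z / poly_to_fls X)"
proof -
  define qs where
    "qs = [[:2 / k:]] @ map uminus as @ [[:(-1) ^ (n + 1) * 2 * t / k:]] @ rev as"
  let ?p = poly_to_fls
  let ?c = fls_const
  define \<epsilon> where "\<epsilon> = ?p X + ?p Y * sqrtD"
  define \<epsilon>' where "\<epsilon>' = ?p X - ?p Y * sqrtD"
  have "(2 :: 'a) \<noteq> 0"
  proof
    assume "(2 :: 'a) = 0"
    then have "CHAR('a) dvd 2"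
      using of_nat_eq_0_iff_char_dvd[of 2, where ?'a = 'a] by simp
    then have "CHAR('a) = 1 \<or> CHAR('a) = 2"
      by (metis two_is_prime_nat prime_nat_iff)
    with assms(1) CHAR_not_1'[where ?'a = 'a] show False
      by simp
  qed
  have t: "t * t = 1" "t \<noteq> 0"
    using assms(5) by auto

  \<comment> \<open>Orders of the two conjugates and of \<alpha>\<close>
  have degX: "degree X > 0"
    using assms(9) by simp
  then have X: "X \<noteq> 0"
    by auto
  have "\<epsilon> * \<epsilon>' = ?p (X\<^sup>2 - D * Y\<^sup>2)"
    by (simp add: \<epsilon>_def \<epsilon>'_def poly_to_fls_diff poly_to_fls_mult power2_eq_square algebra_simps
        flip: assms(3)[unfolded power2_eq_square])
  then have \<epsilon>_mult: "\<epsilon> * \<epsilon>' = ?c t"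
    by (simp add: assms(6))
  have \<epsilon>_add: "\<epsilon> + \<epsilon>' = ?c 2 * ?p X"
    by (simp add: \<epsilon>_def \<epsilon>'_def)
  have \<epsilon>_nz: "\<epsilon> \<noteq> 0" "\<epsilon>' \<noteq> 0"
    using \<epsilon>_mult t(2) by auto
  \<comment> \<open>The norm is a nonzero constant, so the orders are opposite; then
    \<open>\<epsilon>\<close>, being \<open>2 * X - \<epsilon>'\<close>, has the order of
    \<open>X\<close>.\<close>
  have "fls_subdegree \<epsilon> + fls_subdegree \<epsilon>' = 0"
    using fls_subdegree_mult[OF \<epsilon>_nz] \<epsilon>_mult by simp
  then have sub_\<epsilon>': "fls_subdegree \<epsilon>' > 0"
    using assms(7) by (simp add: \<epsilon>_def)
  have sub_2X: "fls_subdegree (?c 2 * ?p X) = - int (degree X)"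
    using X \<open>2 \<noteq> 0\<close>
    by (simp add: fls_subdegree_poly_to_fls flip: poly_to_fls_smult del: fls_const_numeral)
  have "fls_subdegree (?c 2 * ?p X - \<epsilon>') = - int (degree X)"
    using fls_subdegree_diff_eq1[of "?c 2 * ?p X" \<epsilon>'] sub_2X sub_\<epsilon>' X \<open>2 \<noteq> 0\<close>
    by (simp del: fls_const_numeral)
  then have sub_\<epsilon>: "fls_subdegree \<epsilon> = - int (degree X)"
    unfolding \<epsilon>_add[symmetric] by simp
  \<comment> \<open>Subtracting \<open>k * Z\<close> leaves the order of the numerator unchanged; so
    \<alpha> has order 0, matching the constant that opens the block.\<close>
  have "fls_subdegree \<epsilon> < fls_subdegree (?p (smult k Z))"
    using assms(9) by (simp add: sub_\<epsilon> fls_subdegree_poly_to_fls)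
  note sub_num = fls_subdegree_diff_eq1[OF \<epsilon>_nz(1) this]
  have num_nz: "\<epsilon> - ?p (smult k Z) \<noteq> 0"
    using sub_num sub_\<epsilon> degX by auto
  have \<alpha>_eq: "\<alpha> = (\<epsilon> - ?p (smult k Z)) / ?p (smult k X)"
    using assms(15) by (simp add: \<epsilon>_def poly_to_fls_smult algebra_simps)
  have \<alpha>: "\<alpha> \<noteq> 0" "fls_subdegree \<alpha> = 0"
    using num_nz sub_num sub_\<epsilon> X assms(12)
    by (simp_all add: \<alpha>_eq fls_divide_subdegree fls_subdegree_poly_to_fls)

  \<comment> \<open>Index 0 holds the entry 0, so \<open>as ! j\<close> is the partial quotient at
    \<open>Suc j\<close>.\<close>
  have pq: "partial_quotient (?p Z / ?p X) (Suc j) = Some (as ! j)" if "j < n" for j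
    using assms(10,11) that by (simp add: has_finite_regular_cf_def)
  have deg_as: "degree a > 0" if "a \<in> set as" for a
    using that degree_partial_quotient_pos pq assms(10) by (metis in_set_conv_nth)

  obtain P Q R S where mat: "cf_mat as = (P, Q, R, S)"
    by (metis prod_cases4)
  have PR: "P = smult k X" "R = smult k Z"
    using continuant_cf_mat[OF mat] assms(13,14) by auto
  \<comment> \<open>The empty product has \<open>P = 1\<close>, but here \<open>P\<close> has
    positive degree.\<close>
  have "as \<noteq> []"
    using mat PR(1) degX assms(12) by (auto dest!: arg_cong[where f = degree])
  define s :: "'a" where "s = (-1) ^ n"
  have s: "s * s = 1" "s \<noteq> 0"
    by (auto simp: s_def simp flip: power_mult_distrib)
  have s_pow: "(-1) ^ length as = [:s:]"
    using assms(10) by (simp add: s_def poly_const_pow one_pCons)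
  have det: "?p P * ?p S - ?p Q * ?p R = ?c s"
    using arg_cong[OF cf_mat_det[OF mat], of ?p]
    by (simp add: s_pow poly_to_fls_diff poly_to_fls_mult)
  have hd_as: "degree (hd as) > 0" "degree (hd (rev as)) > 0" "degree (hd (map uminus as)) > 0"
    using \<open>as \<noteq> []\<close> deg_as by (auto simp: hd_rev hd_map)

  have iso_rev: "isolated_consts (rev as)"
    using isolated_consts_append[of "rev as" "[]"] deg_as by simp
  have c_nz: "(-1) ^ (n + 1) * 2 * t / k \<noteq> 0"
    using \<open>2 \<noteq> 0\<close> t(2) assms(12) by simp
  then have iso_mid: "isolated_consts ([:(-1) ^ (n + 1) * 2 * t / k:] # rev as)"
    using hd_as(2) \<open>as \<noteq> []\<close> iso_rev by simp
  have iso: "isolated_consts qs"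
    using iso_mid hd_as(3) \<open>as \<noteq> []\<close> \<open>2 \<noteq> 0\<close> assms(12) deg_as
      isolated_consts_append[of "map uminus as" "[:(-1) ^ (n + 1) * 2 * t / k:] # rev as"]
    by (auto simp: qs_def)

  \<comment> \<open>The block fixes \<alpha>\<close>
  define y where "y = cf_tail (rev as) \<alpha>"
  define w where "w = cf_tail ([:(-1) ^ (n + 1) * 2 * t / k:] # rev as) \<alpha>"
  define x where "x = cf_tail (map uminus as) w"
  have y: "y \<noteq> 0" "y * (?p Q * \<alpha> + ?p S) = ?p P * \<alpha> + ?p R"
    using cf_tail_mobius[of "rev as" \<alpha> P R Q S] \<alpha> deg_as mat
    by (auto simp: y_def cf_mat_rev)
  have w: "w \<noteq> 0" "fls_subdegree w \<le> 0"
    using cf_tail_isolated_consts[OF iso_mid \<alpha>] by (auto simp: w_def)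
  \<comment> \<open>Negating the entries leaves a common factor \<open>s\<close>, which is cancelled
    in the final form of \<open>x\<close>.\<close>
  have "cf_mat (map uminus as) =
      (smult s P, - smult s Q, - smult s R, smult s S)"
    using mat by (simp add: cf_mat_map_uminus s_pow)
  note mobius = cf_tail_mobius[OF _ w this]
  have "degree p > 0" if "p \<in> set (map uminus as)" for p
    using that deg_as by auto
  from mobius[OF this] have x_nz: "x \<noteq> 0"
    and x: "x * (?c s * (- ?p R * w + ?p S)) = ?c s * (?p P * w - ?p Q)"
    by (simp_all add: x_def poly_to_fls_minus poly_to_fls_smult algebra_simps)
  have x: "x * (- ?p R * w + ?p S) = ?p P * w - ?p Q"
  proof -
    have "?c s * (x * (- ?p R * w + ?p S)) = ?c s * (?p P * w - ?p Q)"
      using x by (simp only: mult.left_commute)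
    then show ?thesis
      using s(2) by simp
  qed
  have "2 / ?c k + 1 / x = \<alpha>"
  proof (rule block_fixed_point[where P = "?p P" and X = "?p X" and y = y and s = "?c s"])
    show "?p P \<noteq> 0" "?c k \<noteq> 0"
      using PR(1) X assms(12) by auto
    show "?c s * ?c s = 1" "?c t * ?c t = 1"
      using s t by simp_all
    show "?p P = ?c k * ?p X"
      by (simp add: PR poly_to_fls_smult)
    show "?p P * \<alpha> = \<epsilon> - ?p R"
      using \<alpha>_eq PR X assms(12) by simp
    show "\<epsilon> + \<epsilon>' = 2 * ?p X"
      using \<epsilon>_add by simp
    \<comment> \<open>The sign \<open>(-1) ^ (n + 1)\<close> is \<open>- s\<close>.\<close>
    show "w = - ?c s * 2 * ?c t / ?c k + 1 / y"
      by (simp add: w_def y_def s_def fls_const_divide_const flip: fls_const_numeral)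
  qed (use det \<epsilon>_mult y x x_nz in auto)
  then have fixed: "cf_tail qs \<alpha> = \<alpha>"
    by (simp add: qs_def cf_tail_append x_def w_def fls_const_divide_const
        flip: fls_const_numeral)

  \<comment> \<open>Tail 0 of this expansion is \<open>cf_tail qs \<alpha>\<close>, which
    \<open>fixed\<close> identifies with \<alpha>.\<close>
  interpret cf_expansion "\<lambda>i. qs ! (i mod length qs)" "\<lambda>i. cf_tail (drop (i mod length qs) qs) \<alpha>"
    using iso \<alpha> fixed by (intro cf_expansion_periodic) (auto simp: qs_def)
  have qs_nonempty: "length qs > 0"
    by (simp add: qs_def)
  have "[?c (2 / k)] @ map (\<lambda>a. - ?p a) as @ [?c ((-1) ^ (n + 1) * 2 * t / k)] @ map ?p (rev as)
      = map ?p qs"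
    by (simp add: qs_def poly_to_fls_minus)
  moreover have "periodic (map ?p qs) = (\<lambda>i. ?p (qs ! (i mod length qs)))"
    using qs_nonempty by (auto simp: periodic_def)
  moreover have "has_cf_limit (\<lambda>i. ?p (qs ! (i mod length qs))) \<alpha>"
    using has_cf_limit by (simp add: fixed)
  moreover have "K_sup \<alpha> \<le> K_sup (?p Z / ?p X)"
    unfolding K_sup_def[of \<alpha>]
  proof (rule Sup_least, clarify)
    fix a j
    assume "j \<ge> 1" "partial_quotient \<alpha> j = Some a"
    then obtain i where i: "degree (qs ! (i mod length qs)) > 0"
      "degree a = degree (qs ! (i mod length qs))"
      using degree_partial_quotient[of j a] by (auto simp: fixed)
    have "qs ! (i mod length qs) \<in> set qs"
      using qs_nonempty by simp
    \<comment> \<open>Positive degree excludes the two constants; every other entry of the block is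
      an element of \<open>as\<close> up to sign.\<close>
    then obtain b where "b \<in> set as" "degree a = degree b"
      using i by (auto simp: qs_def)
    then obtain l where "l < n" "degree a = degree (as ! l)"
      using assms(10) by (metis in_set_conv_nth)
    then show "enat (degree a) \<le> K_sup (?p Z / ?p X)"
      unfolding K_sup_def using pq
      by (intro Sup_upper CollectI exI[of _ "as ! l"] exI[of _ "Suc l"]) simp
  qed
  ultimately show ?thesis
    by metis
qed

end
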